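(* For every $w\in S_\infty$, the coefficients $c^F_w(\mathbf t)\in\mathbb Z[\mathbf t]$ in the expansion $$\mathfrak S_w(\mathbf x;\mathbf t)=\sum_F c^F_w(\mathbf t)\,\mathfrak P_F(\mathbf x;\mathbf t)$$ are Graham-positive, i.e. lie in $\mathbb Z_{\ge0}[t_2-t_1,t_3-t_2,\dots]$.
   Context: $\mathbf x=(x_1,x_2,\dots)$, $\mathbf t=(t_1,t_2,\dots)$. $S_\infty$ is the group of permutations of $\mathbb N$ fixing all but finitely many elements, acting on $\mathbb Z[\mathbf t][\mathbf x]$ by permuting the $x$-variables; $s_i=(i,i+1)$, $\partial_if=(f-s_if)/(x_i-x_{i+1})$. Double Schubert polynomials $\mathfrak S_w$: the unique homogeneous family ($\deg x_i=\deg t_i=1$) with $\mathfrak S_w(\mathbf t;\mathbf t)=\delta_{w,\mathrm{id}}$ and $\partial_i\mathfrak S_w=\mathfrak S_{ws_i}$ if $\ell(ws_i)<\ell(w)$, else $0$. Indexed forests: sequences $F=(T_1,T_2,\dots)$ of binary plane trees (each node a leaf or an internal node with ordered left/right children), all but finitely many one-node trees; leaves identified with $\mathbb N$ left to right; $\emptyset$ has no internal nodes. $\rho_F(v)$: leaf reached from internal node $v$ going repeatedly to left children; terminal: both children leaves; $\mathrm{Qdes}(F)=\{\rho_F(v):v\text{ terminal}\}$; $F/i$ deletes the terminal node with $\rho_F(v)=i$ (replacing it and its leaves by one leaf, relabeling). Double forest polynomials: $R_i^-f=f(x_1,\dots,x_{i-1},t_i,x_i,\dots;\mathbf t)$, $R_i^+f=f(x_1,\dots,x_i,t_i,x_{i+1},\dots;\mathbf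 t)$, $E_if=(R_i^+f-R_i^-f)/(x_i-t_i)$; $\mathfrak P_F$ is the unique homogeneous family with $\mathfrak P_F(\mathbf t;\mathbf t)=\delta_{F,\emptyset}$ and $E_i\mathfrak P_F=\mathfrak P_{F/i}(\mathbf x;\widehat{\mathbf t}_i)$ if $i\in\mathrm{Qdes}(F)$, else $0$, $\widehat{\mathbf t}_i=(t_1,\dots,t_{i-1},t_{i+1},\dots)$. These form a $\mathbb Z[\mathbf t]$-basis of $\mathbb Z[\mathbf t][\mathbf x]$. *)

theory Defs
  imports Main "HOL-Library.Poly_Mapping"
begin

section \<open>Polynomials in Z[t][x] (variables 0-indexed: x_0, x_1, ..., t_0, t_1, ...)\<close>

datatype var = X nat | T nat

type_synonym mono = "var \<Rightarrow>\<^sub>0 nat"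
type_synonym poly = "mono \<Rightarrow>\<^sub>0 int"

definition pvar :: "var \<Rightarrow> poly" where
  "pvar v = Poly_Mapping.single (Poly_Mapping.single v 1) 1"

definition pconst :: "int \<Rightarrow> poly" where
  "pconst c = Poly_Mapping.single 0 c"

definition psubst :: "(var \<Rightarrow> poly) \<Rightarrow> poly \<Rightarrow> poly" where
  "psubst \<sigma> p = sum (\<lambda>m::mono. pconst (Poly_Mapping.lookup p m) *
                    prod (\<lambda>v. \<sigma> v ^ Poly_Mapping.lookup m v) (Poly_Mapping.keys m)) (Poly_Mapping.keys p)"

definition homogeneous :: "poly \<Rightarrow> bool" where
  "homogeneous p \<longleftrightarrow> (\<exists>d. \<forall>m\<in>Poly_Mapping.keys p. (\<Sum>v\<in>Poly_Mapping.keys (m::mono). Poly_Mapping.lookup m v) = d)"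

definition in_Zt :: "poly \<Rightarrow> bool" where
  "in_Zt p \<longleftrightarrow> (\<forall>m\<in>Poly_Mapping.keys p. \<forall>v\<in>Poly_Mapping.keys (m::mono). \<exists>j. v = T j)"

definition spec_tt :: "poly \<Rightarrow> poly" where
  "spec_tt = psubst (\<lambda>v. case v of X i \<Rightarrow> pvar (T i) | T i \<Rightarrow> pvar (T i))"

text \<open>Graham positivity: lying in Z_{>=0}[t_1 - t_0, t_2 - t_1, ...]
  (i.e. Z_{>=0}[t_2-t_1, t_3-t_2, ...] in 1-indexed notation).\<close>
definition graham_positive :: "poly \<Rightarrow> bool" where
  "graham_positive c \<longleftrightarrow>
     (\<exists>q::poly. in_Zt q \<and> (\<forall>m. Poly_Mapping.lookup q m \<ge> 0) \<and>
        c = psubst (\<lambda>v. case v of T j \<Rightarrow> pvar (T (Suc j)) - pvar (T j)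
                                | X j \<Rightarrow> pvar (X j)) q)"

definition finperm :: "(nat \<Rightarrow> nat) \<Rightarrow> bool" where
  "finperm w \<longleftrightarrow> bij w \<and> finite {i. w i \<noteq> i}"

definition perm_length :: "(nat \<Rightarrow> nat) \<Rightarrow> nat" where
  "perm_length w = card {(i, j). i < j \<and> w j < w i}"

definition sref :: "nat \<Rightarrow> nat \<Rightarrow> nat" where
  "sref i j = (if j = i then Suc i else if j = Suc i then i else j)"

definition swapx :: "nat \<Rightarrow> poly \<Rightarrow> poly" where
  "swapx i = psubst (\<lambda>v. case v of X j \<Rightarrow> pvar (X (sref i j)) | T j \<Rightarrow> pvar (T j))"

definition ddiff :: "nat \<Rightarrow> poly \<Rightarrow> poly" where
  "ddiff i f = (THE g. (pvar (X i) - pvar (X (Suc i))) * g = f - swapx i f)"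

definition is_double_schubert_family :: "((nat \<Rightarrow> nat) \<Rightarrow> poly) \<Rightarrow> bool" where
  "is_double_schubert_family S \<longleftrightarrow>
     (\<forall>w. finperm w \<longrightarrow> homogeneous (S w)) \<and>
     (\<forall>w. finperm w \<longrightarrow> spec_tt (S w) = (if w = id then 1 else 0)) \<and>
     (\<forall>w i. finperm w \<longrightarrow>
        ddiff i (S w) = (if perm_length (w \<circ> sref i) < perm_length w
                         then S (w \<circ> sref i) else 0))"

datatype tree = Leaf | Node tree tree

fun leaves :: "tree \<Rightarrow> nat" where
  "leaves Leaf = 1"
| "leaves (Node l r) = leaves l + leaves r"

text \<open>Leftmost leaves (0-based within the tree) of terminal internal nodes.\<close>
fun tdes :: "tree \<Rightarrow> nat set" where
  "tdes Leaf = {}"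
| "tdes (Node l r) = (if l = Leaf \<and> r = Leaf then {0}
                      else tdes l \<union> (\<lambda>k. leaves l + k) ` tdes r)"

fun tdel :: "nat \<Rightarrow> tree \<Rightarrow> tree" where
  "tdel i Leaf = Leaf"
| "tdel i (Node l r) = (if l = Leaf \<and> r = Leaf then Leaf
                        else if i < leaves l then Node (tdel i l) r
                        else Node l (tdel (i - leaves l) r))"

type_synonym forest = "nat \<Rightarrow> tree"

definition indexed_forest :: "forest \<Rightarrow> bool" where
  "indexed_forest F \<longleftrightarrow> finite {k. F k \<noteq> Leaf}"

definition empty_forest :: forest where
  "empty_forest = (\<lambda>_. Leaf)"

text \<open>Label of the first leaf of tree k (leaves numbered 0,1,2,... left to right).\<close>
definition offset :: "forest \<Rightarrow> nat \<Rightarrow> nat" where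
  "offset F k = (\<Sum>j<k. leaves (F j))"

definition Qdes :: "forest \<Rightarrow> nat set" where
  "Qdes F = (\<Union>k. (\<lambda>a. offset F k + a) ` tdes (F k))"

definition tree_of_leaf :: "forest \<Rightarrow> nat \<Rightarrow> nat" where
  "tree_of_leaf F i = (THE k. offset F k \<le> i \<and> i < offset F (Suc k))"

definition fdel :: "forest \<Rightarrow> nat \<Rightarrow> forest" where
  "fdel F i = (let k = tree_of_leaf F i in F(k := tdel (i - offset F k) (F k)))"

definition Rminus :: "nat \<Rightarrow> poly \<Rightarrow> poly" where
  "Rminus i = psubst (\<lambda>v. case v of
      X j \<Rightarrow> (if j < i then pvar (X j) else if j = i then pvar (T i) else pvar (X (j - 1)))
    | T j \<Rightarrow> pvar (T j))"

definition Rplus :: "nat \<Rightarrow> poly \<Rightarrow> poly" where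
  "Rplus i = psubst (\<lambda>v. case v of
      X j \<Rightarrow> (if j \<le> i then pvar (X j) else if j = Suc i then pvar (T i) else pvar (X (j - 1)))
    | T j \<Rightarrow> pvar (T j))"

definition Eop :: "nat \<Rightarrow> poly \<Rightarrow> poly" where
  "Eop i f = (THE g. (pvar (X i) - pvar (T i)) * g = Rplus i f - Rminus i f)"

definition omit_t :: "nat \<Rightarrow> poly \<Rightarrow> poly" where
  "omit_t i = psubst (\<lambda>v. case v of
      X j \<Rightarrow> pvar (X j)
    | T j \<Rightarrow> (if j < i then pvar (T j) else pvar (T (Suc j))))"

definition is_double_forest_family :: "(forest \<Rightarrow> poly) \<Rightarrow> bool" where
  "is_double_forest_family P \<longleftrightarrow>
     (\<forall>F. indexed_forest F \<longrightarrow> homogeneous (P F)) \<and>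
     (\<forall>F. indexed_forest F \<longrightarrow> spec_tt (P F) = (if F = empty_forest then 1 else 0)) \<and>
     (\<forall>F i. indexed_forest F \<longrightarrow>
        Eop i (P F) = (if i \<in> Qdes F then omit_t i (P (fdel F i)) else 0))"

end

(*
  Write ins_i for the substitution x_i := t_i, x_{j+1} := x_j (j >= i). Then E_i = ins_i o ddiff_i,
  so a coefficient c^F_w is obtained from the double Schubert polynomial S_w by alternately applying
  divided differences and insertions and finally setting x = t. Divided differences map Schubert
  polynomials to Schubert polynomials, so it suffices that inserting a parameter preserves
  Graham positivity of all the values of D_v f at x = t, D_v being the divided difference
  operator of v. For this the inserted parameter t_k is allowed at any position i. If v has a descent
  away from i - 1 it can be commuted past the insertion, shortening v. Otherwise the position is
  moved by one step, using
    ins_{i+1} f = ins_i f + (x_i - t_k) ins_i (ddiff_i f)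
  and the Chevalley rule for D_v o x_i; the direction can be chosen such that all terms are positive,
  unless v = id and i = k, where the value is that of f itself.
*)
theory Submission
  imports Defs
begin

section \<open>Polynomial substitution\<close>

text \<open>The library derives the integral domain structure from a linear order on the variables.\<close>
instantiation var :: linorder
begin

fun var_code :: "var \<Rightarrow> nat" where
  "var_code (X n) = 2 * n"
| "var_code (T n) = Suc (2 * n)"

definition less_eq_var :: "var \<Rightarrow> var \<Rightarrow> bool" where
  "less_eq_var a b \<longleftrightarrow> var_code a \<le> var_code b"

definition less_var :: "var \<Rightarrow> var \<Rightarrow> bool" where
  "less_var a b \<longleftrightarrow> var_code a < var_code b"

instance
proof
  fix a b :: var
  assume "a \<le> b" "b \<le> a"
  then show "a = b"
    by (cases a; cases b) (auto simp: less_eq_var_def, presburger+)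
qed (auto simp: less_eq_var_def less_var_def)

end

definition mono_subst :: "(var \<Rightarrow> poly) \<Rightarrow> mono \<Rightarrow> poly" where
  "mono_subst \<sigma> m = (\<Prod>v\<in>Poly_Mapping.keys m. \<sigma> v ^ Poly_Mapping.lookup m v)"

lemma mono_subst_superset:
  assumes "finite A" "Poly_Mapping.keys m \<subseteq> A"
  shows "mono_subst \<sigma> m = (\<Prod>v\<in>A. \<sigma> v ^ Poly_Mapping.lookup m v)"
  unfolding mono_subst_def using assms
  by (intro prod.mono_neutral_left) (auto simp: in_keys_iff)

lemma mono_subst_0 [simp]: "mono_subst \<sigma> 0 = 1"
  by (simp add: mono_subst_def)

lemma mono_subst_add: "mono_subst \<sigma> (m + n) = mono_subst \<sigma> m * mono_subst \<sigma> n"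
proof -
  let ?A = "Poly_Mapping.keys m \<union> Poly_Mapping.keys n"
  have "mono_subst \<sigma> (m + n) = (\<Prod>v\<in>?A. \<sigma> v ^ Poly_Mapping.lookup (m + n) v)"
    by (rule mono_subst_superset) (auto simp: Poly_Mapping.keys_add)
  also have "\<dots> = (\<Prod>v\<in>?A. \<sigma> v ^ Poly_Mapping.lookup m v) * (\<Prod>v\<in>?A. \<sigma> v ^ Poly_Mapping.lookup n v)"
    by (simp add: lookup_add power_add prod.distrib)
  also have "\<dots> = mono_subst \<sigma> m * mono_subst \<sigma> n"
    by (simp add: mono_subst_superset[of ?A])
  finally show ?thesis .
qed

lemma mono_subst_single: "mono_subst \<sigma> (Poly_Mapping.single v k) = \<sigma> v ^ k"
  by (cases "k = 0") (simp_all add: mono_subst_def)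

lemma pconst_add: "pconst (a + b) = pconst a + pconst b"
  by (simp add: pconst_def single_add)

lemma pconst_mult: "pconst (a * b) = pconst a * pconst b"
  by (simp add: pconst_def mult_single)

lemma pconst_0 [simp]: "pconst 0 = 0"
  by (simp add: pconst_def)

lemma pconst_1 [simp]: "pconst 1 = 1"
  by (simp add: pconst_def)

lemma psubst_alt: "psubst \<sigma> p = (\<Sum>m\<in>Poly_Mapping.keys p. pconst (Poly_Mapping.lookup p m) * mono_subst \<sigma> m)"
  by (simp add: psubst_def mono_subst_def)

lemma psubst_add [simp]: "psubst \<sigma> (p + q) = psubst \<sigma> p + psubst \<sigma> q"
  unfolding psubst_alt
  by (rule setsum_keys_plus_distrib) (simp_all add: pconst_add algebra_simps)

lemma psubst_0 [simp]: "psubst \<sigma> 0 = 0"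
  by (simp add: psubst_def)

lemma psubst_single: "psubst \<sigma> (Poly_Mapping.single m c) = pconst c * mono_subst \<sigma> m"
  by (cases "c = 0") (simp_all add: psubst_alt)

lemma psubst_minus [simp]: "psubst \<sigma> (- p) = - psubst \<sigma> p"
  using psubst_add[of \<sigma> p "- p"] by (simp add: eq_neg_iff_add_eq_0 add.commute)

lemma psubst_diff [simp]: "psubst \<sigma> (p - q) = psubst \<sigma> p - psubst \<sigma> q"
  using psubst_add[of \<sigma> p "- q"] by simp

lemma psubst_1 [simp]: "psubst \<sigma> 1 = 1"
  using psubst_single[of \<sigma> 0 1] by simp

lemma psubst_pconst [simp]: "psubst \<sigma> (pconst c) = pconst c"
  using psubst_single[of \<sigma> 0 c] by (simp add: pconst_def)

lemma psubst_pvar [simp]: "psubst \<sigma> (pvar v) = \<sigma> v"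
  by (simp add: pvar_def psubst_single mono_subst_single)

lemma psubst_sum: "psubst \<sigma> (sum f A) = (\<Sum>a\<in>A. psubst \<sigma> (f a))"
  by (induction A rule: infinite_finite_induct) simp_all

lemma psubst_sum_list: "psubst \<sigma> (sum_list ps) = (\<Sum>p\<leftarrow>ps. psubst \<sigma> p)"
  by (induction ps) simp_all

lemma poly_sum_single:
  "(p :: poly) = (\<Sum>m\<in>Poly_Mapping.keys p. Poly_Mapping.single m (Poly_Mapping.lookup p m))"
  by (rule poly_mapping_eqI)
     (auto simp: lookup_sum lookup_single when_def sum.delta in_keys_iff)

lemma poly_induct_single [case_names single add]:
  assumes "\<And>m c. Q (Poly_Mapping.single m c)" "\<And>p q. Q p \<Longrightarrow> Q q \<Longrightarrow> Q (p + q)"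
  shows "Q (p :: poly)"
proof -
  have "Q (\<Sum>m\<in>A. Poly_Mapping.single m (Poly_Mapping.lookup p m))" if "finite A" for A
    using that
  proof (induction A rule: finite_induct)
    case empty
    show ?case using assms(1)[of 0 0] by simp
  qed (simp add: assms)
  from this[OF finite_keys, of p] show ?thesis
    by (subst poly_sum_single) simp
qed

lemma psubst_mult [simp]: "psubst \<sigma> (p * q) = psubst \<sigma> p * psubst \<sigma> q"
proof (induction p rule: poly_induct_single)
  case (single m c)
  show ?case
  proof (induction q rule: poly_induct_single)
    case (single n d)
    show ?case
      by (simp add: mult_single psubst_single pconst_mult mono_subst_add algebra_simps)
  qed (simp add: algebra_simps)
qed (simp add: algebra_simps)

lemma psubst_prod: "psubst \<sigma> (prod f A) = (\<Prod>a\<in>A. psubst \<sigma> (f a))"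
  by (induction A rule: infinite_finite_induct) simp_all

lemma psubst_power: "psubst \<sigma> (p ^ n) = psubst \<sigma> p ^ n"
  by (induction n) simp_all

lemma psubst_psubst: "psubst \<sigma> (psubst \<rho> p) = psubst (\<lambda>v. psubst \<sigma> (\<rho> v)) p"
  unfolding psubst_def[of \<rho>] psubst_def[of "\<lambda>v. psubst \<sigma> (\<rho> v)"]
  by (simp add: psubst_sum psubst_prod psubst_power)

lemma psubst_cong:
  assumes "\<And>m v. m \<in> Poly_Mapping.keys p \<Longrightarrow> v \<in> Poly_Mapping.keys m \<Longrightarrow> \<sigma> v = \<rho> v"
  shows "psubst \<sigma> p = psubst \<rho> p"
  unfolding psubst_def using assms by (intro sum.cong prod.cong arg_cong2[where f = "(*)"]) auto

lemma mono_subst_pvar: "mono_subst pvar m = Poly_Mapping.single m 1"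
proof (induction m rule: update_induct)
  case const
  show ?case by simp
next
  case (update f a b)
  \<comment> \<open>The key \<open>a\<close> is new, so the update only multiplies the monomial by a
    power of one further variable.\<close>
  have *: "Poly_Mapping.update a b f = f + Poly_Mapping.single a b"
    using update(1)
    by (intro poly_mapping_eqI) (auto simp: lookup_update lookup_add lookup_single in_keys_iff when_def)
  have "pvar a ^ b = Poly_Mapping.single (Poly_Mapping.single a b) (1::int)"
  proof (induction b)
    case (Suc b)
    have "Poly_Mapping.single a (Suc b) = Poly_Mapping.single a 1 + Poly_Mapping.single a b"
      by (simp flip: single_add)
    moreover have "pvar a ^ Suc b = pvar a * Poly_Mapping.single (Poly_Mapping.single a b) 1"
      by (simp add: Suc)
    ultimately show ?case by (simp add: mult_single pvar_def)
  qed simp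
  then show ?case
    by (simp add: * mono_subst_add update mono_subst_single mult_single)
qed

lemma psubst_pvar_id: "psubst pvar p = p"
proof -
  have "psubst pvar p = (\<Sum>m\<in>Poly_Mapping.keys p. Poly_Mapping.single m (Poly_Mapping.lookup p m))"
    by (simp add: psubst_alt mono_subst_pvar pconst_def mult_single)
  then show ?thesis using poly_sum_single[of p] by simp
qed

lemma psubst_in_Zt:
  assumes "in_Zt p" "\<And>j. \<sigma> (T j) = pvar (T j)"
  shows "psubst \<sigma> p = p"
proof -
  have "psubst \<sigma> p = psubst pvar p"
    using assms unfolding in_Zt_def by (intro psubst_cong) fastforce
  then show ?thesis by (simp add: psubst_pvar_id)
qed

lemma dvd_diff_mult:
  fixes d :: poly
  assumes "d dvd a - a'" "d dvd b - b'"
  shows "d dvd a * b - a' * b'"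
proof -
  have "a * b - a' * b' = (a - a') * b + a' * (b - b')"
    by (simp add: algebra_simps)
  then show ?thesis using assms by (simp add: dvd_add)
qed

text \<open>Congruence modulo \<open>d\<close> is compatible with sums, products and powers.
  Comparing the identity with a swap of two variables, this yields the divisibility behind
  \<open>ddiff\<close>.\<close>

lemma dvd_psubst_diff:
  assumes "\<And>v. d dvd \<sigma> v - \<rho> v"
  shows "d dvd psubst \<sigma> p - psubst \<rho> p"
proof -
  have pow: "d dvd \<sigma> v ^ n - \<rho> v ^ n" for v n
    by (induction n) (simp_all add: dvd_diff_mult assms)
  have "d dvd (\<Prod>v\<in>A. \<sigma> v ^ k v) - (\<Prod>v\<in>A. \<rho> v ^ k v)" for A k
    by (induction A rule: infinite_finite_induct) (simp_all add: dvd_diff_mult pow)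
  then have "d dvd pconst c * (\<Prod>v\<in>A. \<sigma> v ^ k v) - pconst c * (\<Prod>v\<in>A. \<rho> v ^ k v)" for A k c
    by (intro dvd_diff_mult) simp_all
  then show ?thesis
    unfolding psubst_def by (simp flip: sum_subtractf add: dvd_sum)
qed

lemma pvar_eq_iff [simp]: "pvar a = pvar b \<longleftrightarrow> a = b"
  by (metis pvar_def lookup_single_eq lookup_single_not_eq zero_neq_one)

section \<open>Graham positivity\<close>

lemma in_Zt_add: "in_Zt p \<Longrightarrow> in_Zt q \<Longrightarrow> in_Zt (p + q)"
  unfolding in_Zt_def using Poly_Mapping.keys_add[of p q] by blast

lemma in_Zt_mult:
  assumes "in_Zt p" "in_Zt q" shows "in_Zt (p * q)"
  unfolding in_Zt_def
proof (intro ballI)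
  fix m v assume "m \<in> Poly_Mapping.keys (p * q)" "v \<in> Poly_Mapping.keys m"
  then obtain a b where "a \<in> Poly_Mapping.keys p" "b \<in> Poly_Mapping.keys q" "m = a + b"
    using keys_mult[of p q] by blast
  moreover have "v \<in> Poly_Mapping.keys a \<union> Poly_Mapping.keys b"
    using \<open>v \<in> Poly_Mapping.keys m\<close> \<open>m = a + b\<close> Poly_Mapping.keys_add[of a b] by blast
  ultimately show "\<exists>j. v = T j"
    using assms unfolding in_Zt_def by blast
qed

lemma lookup_mult_nonneg:
  fixes p q :: poly
  assumes "\<And>m. 0 \<le> Poly_Mapping.lookup p m" "\<And>m. 0 \<le> Poly_Mapping.lookup q m"
  shows "0 \<le> Poly_Mapping.lookup (p * q) m"
proof -
  have "p * q = (\<Sum>a\<in>Poly_Mapping.keys p. \<Sum>b\<in>Poly_Mapping.keys q.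
      Poly_Mapping.single (a + b) (Poly_Mapping.lookup p a * Poly_Mapping.lookup q b))"
    by (subst poly_sum_single[of p], subst poly_sum_single[of q])
       (simp add: sum_product mult_single)
  then show ?thesis
    by (simp add: lookup_sum lookup_single when_def assms sum_nonneg)
qed

lemma graham_positive_add:
  assumes "graham_positive a" "graham_positive b" shows "graham_positive (a + b)"
proof -
  from assms obtain p q where
    "in_Zt p" "\<forall>m. Poly_Mapping.lookup p m \<ge> 0"
    "a = psubst (\<lambda>v. case v of T j \<Rightarrow> pvar (T (Suc j)) - pvar (T j) | X j \<Rightarrow> pvar (X j)) p"
    "in_Zt q" "\<forall>m. Poly_Mapping.lookup q m \<ge> 0"
    "b = psubst (\<lambda>v. case v of T j \<Rightarrow> pvar (T (Suc j)) - pvar (T j) | X j \<Rightarrow> pvar (X j)) q"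
    unfolding graham_positive_def by blast
  then show ?thesis
    unfolding graham_positive_def by (intro exI[of _ "p + q"]) (simp add: in_Zt_add lookup_add)
qed

lemma graham_positive_mult:
  assumes "graham_positive a" "graham_positive b" shows "graham_positive (a * b)"
proof -
  from assms obtain p q where
    "in_Zt p" "\<forall>m. Poly_Mapping.lookup p m \<ge> 0"
    "a = psubst (\<lambda>v. case v of T j \<Rightarrow> pvar (T (Suc j)) - pvar (T j) | X j \<Rightarrow> pvar (X j)) p"
    "in_Zt q" "\<forall>m. Poly_Mapping.lookup q m \<ge> 0"
    "b = psubst (\<lambda>v. case v of T j \<Rightarrow> pvar (T (Suc j)) - pvar (T j) | X j \<Rightarrow> pvar (X j)) q"
    unfolding graham_positive_def by blast
  then show ?thesis
    unfolding graham_positive_def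
    by (intro exI[of _ "p * q"]) (simp add: in_Zt_mult lookup_mult_nonneg)
qed

lemma graham_positive_0: "graham_positive 0"
  unfolding graham_positive_def by (intro exI[of _ 0]) (simp add: in_Zt_def)

lemma graham_positive_1: "graham_positive 1"
  unfolding graham_positive_def by (intro exI[of _ 1]) (simp add: in_Zt_def lookup_one when_def)

lemma graham_positive_sum_list:
  "(\<And>p. p \<in> set ps \<Longrightarrow> graham_positive p) \<Longrightarrow> graham_positive (sum_list ps)"
  by (induction ps) (simp_all add: graham_positive_0 graham_positive_add)

text \<open>The difference telescopes into differences of consecutive parameters.\<close>

lemma graham_positive_diff:
  assumes "a \<le> b" shows "graham_positive (pvar (T b) - pvar (T a))"
  using assms
proof (induction b rule: dec_induct)
  case base
  show ?case by (simp add: graham_positive_0)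
next
  case (step n)
  have "graham_positive (pvar (T (Suc n)) - pvar (T n))"
    unfolding graham_positive_def
    by (intro exI[of _ "pvar (T n)"])
       (simp, simp add: pvar_def in_Zt_def lookup_single when_def)
  from graham_positive_add[OF this step.IH] show ?case by simp
qed

section \<open>Divided differences\<close>

lemma swapx_hom [simp]:
  "swapx i (p + q) = swapx i p + swapx i q"
  "swapx i (p - q) = swapx i p - swapx i q"
  "swapx i (p * q) = swapx i p * swapx i q"
  "swapx i (pvar (X j)) = pvar (X (sref i j))"
  by (simp_all add: swapx_def)

lemma sref_simps [simp]:
  "sref i i = Suc i" "sref i (Suc i) = i" "sref i (sref i j) = j"
  by (simp_all add: sref_def)

lemma swapx_swapx [simp]: "swapx i (swapx i f) = f"
proof -
  have "swapx i (swapx i f) = psubst pvar f"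
    unfolding swapx_def psubst_psubst by (rule psubst_cong) (simp split: var.split)
  then show ?thesis by (simp add: psubst_pvar_id)
qed

lemma swapx_commute:
  assumes "Suc i < j"
  shows "swapx i (swapx j f) = swapx j (swapx i f)"
  unfolding swapx_def psubst_psubst using assms
  by (intro psubst_cong) (auto simp: sref_def split: var.split)

lemma swapx_braid:
  "swapx i (swapx (Suc i) (swapx i f)) = swapx (Suc i) (swapx i (swapx (Suc i) f))"
  unfolding swapx_def psubst_psubst
  by (intro psubst_cong) (auto simp: sref_def split: var.split)

lemma ddiff_exists: "\<exists>g. (pvar (X i) - pvar (X (Suc i))) * g = f - swapx i f"
proof -
  have "pvar (X i) - pvar (X (Suc i)) dvd psubst pvar f - swapx i f"
    unfolding swapx_def
  proof (rule dvd_psubst_diff)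
    fix v
    have "pvar (X i) - pvar (X (Suc i)) dvd pvar (X (Suc i)) - pvar (X i)"
      by (subst dvd_minus_iff[symmetric]) simp
    then show "pvar (X i) - pvar (X (Suc i)) dvd
        pvar v - (case v of X j \<Rightarrow> pvar (X (sref i j)) | T j \<Rightarrow> pvar (T j))"
      by (auto simp: sref_def split: var.split)
  qed
  then show ?thesis by (auto simp: psubst_pvar_id elim!: dvdE)
qed

text \<open>Polynomials form an integral domain, so the linear factor cancels. Identities for
  \<open>ddiff\<close> are therefore checked after multiplication by that factor.\<close>

lemma ddiff_unique:
  assumes "(pvar (X i) - pvar (X (Suc i))) * g = f - swapx i f"
  shows "ddiff i f = g"
  unfolding ddiff_def
proof (rule the_equality)
  fix h assume "(pvar (X i) - pvar (X (Suc i))) * h = f - swapx i f"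
  with assms have "(pvar (X i) - pvar (X (Suc i))) * h = (pvar (X i) - pvar (X (Suc i))) * g"
    by simp
  then show "h = g" by simp
qed (fact assms)

lemma ddiff_eq: "(pvar (X i) - pvar (X (Suc i))) * ddiff i f = f - swapx i f"
  using ddiff_exists ddiff_unique by metis

lemma ddiff_add [simp]: "ddiff i (f + g) = ddiff i f + ddiff i g"
  by (rule ddiff_unique) (simp add: distrib_left ddiff_eq)

lemma ddiff_0 [simp]: "ddiff i 0 = 0"
  by (rule ddiff_unique) (simp add: swapx_def)

text \<open>Both \<open>f - swapx i f\<close> and the linear factor change sign under the swap, so
  their quotient is invariant.\<close>

lemma swapx_ddiff: "swapx i (ddiff i f) = ddiff i f"
proof -
  have "swapx i ((pvar (X i) - pvar (X (Suc i))) * ddiff i f) = swapx i f - f"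
    by (simp only: ddiff_eq) simp
  then have "(pvar (X i) - pvar (X (Suc i))) * swapx i (ddiff i f) = f - swapx i f"
    by (simp add: algebra_simps)
  from ddiff_unique[OF this] show ?thesis by simp
qed

lemma ddiff_ddiff [simp]: "ddiff i (ddiff i f) = 0"
  by (rule ddiff_unique) (simp add: swapx_ddiff)

lemma ddiff_commute:
  assumes "Suc i < j"
  shows "ddiff i (ddiff j f) = ddiff j (ddiff i f)"
proof (rule ddiff_unique)
  let ?a = "pvar (X i) - pvar (X (Suc i))" and ?b = "pvar (X j) - pvar (X (Suc j))"
  have sa: "swapx j ?a = ?a" "swapx i ?b = ?b"
    using assms by (simp_all add: sref_def)
  have swap: "?b * swapx i (ddiff j f) = swapx i f - swapx j (swapx i f)"
    using arg_cong[OF ddiff_eq[of j f], of "swapx i"] sa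
    by (simp add: swapx_commute[OF assms])
  have "?a * swapx j (ddiff i f) = swapx j f - swapx j (swapx i f)"
    using arg_cong[OF ddiff_eq[of i f], of "swapx j"] sa by simp
  then have "?b * (?a * ddiff j (ddiff i f)) = ?b * (ddiff j f - swapx i (ddiff j f))"
    using ddiff_eq[of j "ddiff i f"] ddiff_eq[of i f] ddiff_eq[of j f] swap by algebra
  moreover have "?b \<noteq> 0" by simp
  ultimately show "?a * ddiff j (ddiff i f) = ddiff j f - swapx i (ddiff j f)"
    using mult_cancel_left by blast
qed

text \<open>After multiplication by the Vandermonde product of the three variables, both sides
  become the same alternating sum over the symmetric group on three letters.\<close>

lemma ddiff_braid:
  "ddiff i (ddiff (Suc i) (ddiff i f)) = ddiff (Suc i) (ddiff i (ddiff (Suc i) f))"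
proof -
  define x y z where "x = pvar (X i)" and "y = pvar (X (Suc i))" and "z = pvar (X (Suc (Suc i)))"
  let ?s = "swapx i" and ?r = "swapx (Suc i)"
  note xyz = x_def[symmetric] y_def[symmetric] z_def[symmetric]
  have s: "?s x = y" "?s y = x" "?s z = z" and r: "?r x = x" "?r y = z" "?r z = y"
    by (simp_all add: x_def y_def z_def sref_def)
  note D1 = ddiff_eq[of i, unfolded xyz] and D2 = ddiff_eq[of "Suc i", unfolded xyz]
  \<comment> \<open>The signed sum of the images of \<open>f\<close> under the six elements of the
    group generated by the two swaps.\<close>
  define W where "W = f - ?s f - ?r f + ?r (?s f) + ?s (?r f) - ?s (?r (?s f))"
  have "(x - y) * (y - z) * (x - z) * ddiff i (ddiff (Suc i) (ddiff i f)) = W"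
  proof -
    define A B where "A = ddiff i f" and "B = ddiff (Suc i) A"
    have 1: "(x - y) * A = f - ?s f" "(y - z) * B = A - ?r A" "(x - y) * ddiff i B = B - ?s B"
      using D1 D2 by (simp_all add: A_def B_def)
    \<comment> \<open>Applying swaps to the defining equations evaluates the swapped copies of
      \<open>A\<close> and \<open>B\<close> that occur in \<open>1\<close>; the factor
      \<open>x - z\<close> arises as the image of \<open>x - y\<close> or
      \<open>y - z\<close>.\<close>
    have 2: "(x - z) * ?r A = ?r f - ?r (?s f)"
      using arg_cong[OF 1(1), of ?r] by (simp add: r)
    have 3: "(y - z) * ?s (?r A) = ?s (?r f) - ?s (?r (?s f))"
      using arg_cong[OF 2, of ?s] by (simp add: s)
    have 4: "(x - z) * ?s B = A - ?s (?r A)"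
      using arg_cong[OF 1(2), of ?s] by (simp add: s A_def swapx_ddiff)
    show ?thesis
      unfolding W_def A_def[symmetric] B_def[symmetric] using 1 2 3 4 by algebra
  qed
  moreover have "(x - y) * (y - z) * (x - z) * ddiff (Suc i) (ddiff i (ddiff (Suc i) f)) = W"
  proof -
    define A B where "A = ddiff (Suc i) f" and "B = ddiff i A"
    have 1: "(y - z) * A = f - ?r f" "(x - y) * B = A - ?s A" "(y - z) * ddiff (Suc i) B = B - ?r B"
      using D1 D2 by (simp_all add: A_def B_def)
    have 2: "(x - z) * ?s A = ?s f - ?s (?r f)"
      using arg_cong[OF 1(1), of ?s] by (simp add: s)
    have 3: "(x - y) * ?r (?s A) = ?r (?s f) - ?s (?r (?s f))"
      using arg_cong[OF 2, of ?r] by (simp add: r swapx_braid)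
    have 4: "(x - z) * ?r B = A - ?r (?s A)"
      using arg_cong[OF 1(2), of ?r] by (simp add: r A_def swapx_ddiff)
    show ?thesis
      unfolding W_def A_def[symmetric] B_def[symmetric] using 1 2 3 4 by algebra
  qed
  moreover have "(x - y) * (y - z) * (x - z) \<noteq> 0"
    by (simp add: x_def y_def z_def)
  ultimately show ?thesis using mult_cancel_left by metis
qed

text \<open>The twisted Leibniz rule for a single variable; the correction term is \<open>g\<close>
  times the divided difference of \<open>pvar (X m)\<close>.\<close>

lemma ddiff_mult_var:
  "ddiff i (pvar (X m) * g) = pvar (X (sref i m)) * ddiff i g
     + (if m = i then g else if m = Suc i then - g else 0)"
proof (rule ddiff_unique)
  have 0: "a * (p * d) = p * g - p * s" if "a * d = g - s" for a d g s p :: poly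
    using that by algebra
  have 1: "(p - q) * (q * d + g) = p * g - q * s"
    "(p - q) * (p * d - g) = q * g - p * s" if "a * d = g - s" "p - q = a" for a d g s p q :: poly
    using that by algebra+
  show "(pvar (X i) - pvar (X (Suc i))) * (pvar (X (sref i m)) * ddiff i g
      + (if m = i then g else if m = Suc i then - g else 0))
    = pvar (X m) * g - swapx i (pvar (X m) * g)"
    using ddiff_eq[of i g] by (auto simp: sref_def 0 1)
qed

section \<open>Permutations\<close>

lemma finperm_id: "finperm id"
  by (simp add: finperm_def)

lemma sref_comp_sref: "sref i \<circ> sref i = id"
  by (simp add: fun_eq_iff)

lemma bij_sref: "bij (sref i)"
  by (rule o_bij[OF sref_comp_sref sref_comp_sref])

lemma finperm_comp_sref:
  assumes "finperm v" shows "finperm (v \<circ> sref i)"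
proof -
  have "{j. (v \<circ> sref i) j \<noteq> j} \<subseteq> {j. v j \<noteq> j} \<union> {i, Suc i}"
    by (auto simp: sref_def)
  then have "finite {j. (v \<circ> sref i) j \<noteq> j}"
    using assms finite_subset unfolding finperm_def by blast
  then show ?thesis
    using assms bij_sref bij_comp unfolding finperm_def by blast
qed

lemma finperm_inj: "finperm v \<Longrightarrow> v a = v b \<longleftrightarrow> a = b"
  unfolding finperm_def bij_def by (auto dest: injD)

lemma finperm_bound:
  assumes "finperm v"
  obtains N where "\<And>j. j \<ge> N \<Longrightarrow> v j = j" "\<And>j. j < N \<Longrightarrow> v j < N"
proof -
  have "finite {j. v j \<noteq> j}" using assms by (simp add: finperm_def)
  then obtain N where N: "\<And>j. v j \<noteq> j \<Longrightarrow> j < N"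
    using finite_nat_set_iff_bounded by auto
  have "v j < N" if "j < N" for j
  proof (rule ccontr)
    assume "\<not> v j < N"
    then have "v (v j) = v j" using N by blast
    then have "v j = j" using finperm_inj[OF assms] by blast
    with that \<open>\<not> v j < N\<close> show False by simp
  qed
  with N show ?thesis using that by (metis leD)
qed

lemma finite_inversions:
  assumes "finperm v" shows "finite {(i, j). i < j \<and> v j < v i}"
proof -
  obtain N where N: "\<And>j. j \<ge> N \<Longrightarrow> v j = j" "\<And>j. j < N \<Longrightarrow> v j < N"
    using finperm_bound[OF assms] by blast
  have "{(i, j). i < j \<and> v j < v i} \<subseteq> {..<N} \<times> {..<N}"
  proof clarsimp
    fix i j assume "i < j" "v j < v i"
    then show "i < N \<and> j < N"
      using N(1)[of i] N(1)[of j] N(2)[of i] by (cases "j < N"; cases "i < N") auto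
  qed
  then show ?thesis using finite_subset by blast
qed

text \<open>Relabeling positions by \<open>sref i\<close> matches the inversions of the two
  permutations, except for the pair \<open>(i, Suc i)\<close>, which is an inversion of
  \<open>v\<close> only.\<close>

lemma perm_length_descent:
  assumes "finperm v" "v (Suc i) < v i"
  shows "perm_length v = Suc (perm_length (v \<circ> sref i))"
proof -
  let ?I = "{(a, b). a < b \<and> v b < v a}"
  let ?J = "{(a, b). a < b \<and> (v \<circ> sref i) b < (v \<circ> sref i) a}"
  have eq: "?I - {(i, Suc i)} = map_prod (sref i) (sref i) ` ?J"
  proof (intro equalityI subsetI)
    fix p assume "p \<in> ?I - {(i, Suc i)}"
    then obtain a b where p: "p = (a, b)" "a < b" "v b < v a" "(a, b) \<noteq> (i, Suc i)" by auto
    then have "sref i a < sref i b" by (auto simp: sref_def)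
    with p have "(sref i a, sref i b) \<in> ?J" "p = map_prod (sref i) (sref i) (sref i a, sref i b)"
      by simp_all
    then show "p \<in> map_prod (sref i) (sref i) ` ?J" by blast
  next
    fix p assume "p \<in> map_prod (sref i) (sref i) ` ?J"
    then obtain a b where p: "p = (sref i a, sref i b)" "a < b" "v (sref i b) < v (sref i a)" by auto
    have "(a, b) \<noteq> (i, Suc i)" using p assms(2) by auto
    then have "sref i a < sref i b" using p(2) by (auto simp: sref_def)
    moreover have "(sref i a, sref i b) \<noteq> (i, Suc i)" using p(2) by (auto simp: sref_def split: if_splits)
    ultimately show "p \<in> ?I - {(i, Suc i)}" using p by simp
  qed
  have "inj_on (map_prod (sref i) (sref i)) ?J"
    by (rule inj_on_inverseI[where g = "map_prod (sref i) (sref i)"]) auto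
  then have "card ?J = card (?I - {(i, Suc i)})"
    by (simp add: eq card_image)
  moreover have "card ?I = Suc (card (?I - {(i, Suc i)}))"
    using assms(2) finite_inversions[OF assms(1)] by (intro card.remove) auto
  ultimately show ?thesis unfolding perm_length_def by simp
qed

lemma perm_length_ascent:
  assumes "finperm v" "v i < v (Suc i)"
  shows "perm_length (v \<circ> sref i) = Suc (perm_length v)"
  using perm_length_descent[of "v \<circ> sref i" i] assms
  by (simp add: finperm_comp_sref comp_assoc sref_comp_sref)

lemma no_descent_id:
  assumes "finperm v" "\<And>i. \<not> v (Suc i) < v i"
  shows "v = id"
proof -
  have "strict_mono v"
    unfolding strict_mono_Suc_iff
    using assms(2) finperm_inj[OF assms(1)] by (metis linorder_neqE_nat n_not_Suc_n)
  obtain N where N: "\<And>j. j \<ge> N \<Longrightarrow> v j = j" "\<And>j. j < N \<Longrightarrow> v j < N"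
    using finperm_bound[OF assms(1)] by blast
  have "v j = j" for j
  proof (rule antisym)
    show "j \<le> v j" using \<open>strict_mono v\<close> by (rule strict_mono_imp_increasing)
    \<comment> \<open>Every step raises the value by at least one. For \<open>k = N\<close> the
      position \<open>j + N\<close> is a fixed point, which bounds \<open>v j\<close> from
      above.\<close>
    have "v j + k \<le> v (j + k)" for k
      by (induction k) (use \<open>strict_mono v\<close> in \<open>auto simp: strict_mono_Suc_iff Suc_le_eq intro: le_less_trans\<close>)
    from this[of N] show "v j \<le> j" using N(1)[of "j + N"] by simp
  qed
  then show ?thesis by (simp add: fun_eq_iff)
qed

section \<open>Divided difference operators indexed by permutations\<close>

function dop :: "(nat \<Rightarrow> nat) \<Rightarrow> poly \<Rightarrow> poly" where
  "dop v f = (if finperm v \<and> (\<exists>i. v (Suc i) < v i)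
     then dop (v \<circ> sref (LEAST i. v (Suc i) < v i)) (ddiff (LEAST i. v (Suc i) < v i) f)
     else f)"
  by auto
termination
proof (relation "measure (\<lambda>(v, f). perm_length v)", simp, clarify)
  fix v :: "nat \<Rightarrow> nat" and f i
  assume "finperm v" "v (Suc i) < v i"
  then have "v (Suc (LEAST i. v (Suc i) < v i)) < v (LEAST i. v (Suc i) < v i)"
    by (metis (mono_tags, lifting) LeastI)
  from perm_length_descent[OF \<open>finperm v\<close> this]
  show "((v \<circ> sref (LEAST i. v (Suc i) < v i), ddiff (LEAST i. v (Suc i) < v i) f), v, f)
     \<in> measure (\<lambda>(v, f). perm_length v)" by simp
qed

declare dop.simps [simp del]

lemma dop_id [simp]: "dop id f = f" "dop (\<lambda>a. a) f = f"
  by (subst dop.simps; simp)+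

lemma dop_least_descent:
  assumes "finperm v" "v (Suc j) < v j"
  obtains i where "i \<le> j" "v (Suc i) < v i" "\<And>f. dop v f = dop (v \<circ> sref i) (ddiff i f)"
proof (rule that[of "LEAST i. v (Suc i) < v i"])
  show "(LEAST i. v (Suc i) < v i) \<le> j" using assms(2) by (rule Least_le)
  show "v (Suc (LEAST i. v (Suc i) < v i)) < v (LEAST i. v (Suc i) < v i)"
    using assms(2) by (rule LeastI)
  show "dop v f = dop (v \<circ> sref (LEAST i. v (Suc i) < v i)) (ddiff (LEAST i. v (Suc i) < v i) f)" for f
    using assms by (subst dop.simps) auto
qed

text \<open>Removing the least descent each time, \<open>dop\<close> follows one particular reduced
  word. By induction on the length any other descent may come first: the two choices are reconciled
  by commutation or, for adjacent descents, by the braid relation.\<close>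

lemma dop_descent:
  assumes "finperm v" "v (Suc j) < v j"
  shows "dop v f = dop (v \<circ> sref j) (ddiff j f)"
  using assms
proof (induction "perm_length v" arbitrary: v j f rule: less_induct)
  case less
  note fp = \<open>finperm v\<close>
  obtain i where i: "i \<le> j" "v (Suc i) < v i" "\<And>f. dop v f = dop (v \<circ> sref i) (ddiff i f)"
    using dop_least_descent[OF less.prems] by blast
  have step: "dop u g = dop (u \<circ> sref k) (ddiff k g)"
    if "finperm u" "perm_length u < perm_length v" "u (Suc k) < u k" for u k g
    using less.hyps that by blast
  have len: "perm_length (v \<circ> sref i) < perm_length v" "perm_length (v \<circ> sref j) < perm_length v"
    using perm_length_descent[OF fp] i(2) less.prems(2) by fastforce+
  consider "i = j" | "Suc i < j" | "j = Suc i" using i(1) by linarith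
  then show ?case
  proof cases
    case 1
    then show ?thesis using i(3) by simp
  next
    case 2
    have "dop v f = dop (v \<circ> sref i \<circ> sref j) (ddiff j (ddiff i f))"
      using step[of "v \<circ> sref i" j] len fp 2 less.prems(2)
      by (simp add: i(3) finperm_comp_sref sref_def)
    moreover have "dop (v \<circ> sref j) (ddiff j f) = dop (v \<circ> sref j \<circ> sref i) (ddiff i (ddiff j f))"
      using step[of "v \<circ> sref j" i] len fp 2 i(2)
      by (simp add: finperm_comp_sref sref_def)
    moreover have "v \<circ> sref i \<circ> sref j = v \<circ> sref j \<circ> sref i"
      using 2 by (auto simp: fun_eq_iff sref_def)
    ultimately show ?thesis using ddiff_commute[OF 2] by simp
  next
    case 3
    \<comment> \<open>Three consecutive values decrease, so both three-letter words shorten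
      \<open>v\<close> at every letter, and they lead to the same permutation.\<close>
    have d: "v (Suc i) < v i" "v (Suc (Suc i)) < v (Suc i)" using i(2) less.prems(2) 3 by simp_all
    note fps = finperm_comp_sref[OF fp] finperm_comp_sref[OF finperm_comp_sref[OF fp]]
    have 1: "dop (v \<circ> sref i) (ddiff i f)
        = dop (v \<circ> sref i \<circ> sref (Suc i)) (ddiff (Suc i) (ddiff i f))"
      using d len fps by (intro step) (simp_all add: sref_def)
    have "perm_length (v \<circ> sref i \<circ> sref (Suc i)) < perm_length (v \<circ> sref i)"
      using perm_length_descent[OF fps(1), of i "Suc i"] d by (simp add: sref_def)
    then have 2: "dop (v \<circ> sref i \<circ> sref (Suc i)) (ddiff (Suc i) (ddiff i f))
        = dop (v \<circ> sref i \<circ> sref (Suc i) \<circ> sref i) (ddiff i (ddiff (Suc i) (ddiff i f)))"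
      using d len fps by (intro step) (simp_all add: sref_def)
    have 4: "dop (v \<circ> sref (Suc i)) (ddiff (Suc i) f)
        = dop (v \<circ> sref (Suc i) \<circ> sref i) (ddiff i (ddiff (Suc i) f))"
      using d len fps 3 by (intro step) (simp_all add: sref_def)
    have "perm_length (v \<circ> sref (Suc i) \<circ> sref i) < perm_length (v \<circ> sref (Suc i))"
      using perm_length_descent[OF fps(1), of "Suc i" i] d by (simp add: sref_def)
    then have 5: "dop (v \<circ> sref (Suc i) \<circ> sref i) (ddiff i (ddiff (Suc i) f))
        = dop (v \<circ> sref (Suc i) \<circ> sref i \<circ> sref (Suc i)) (ddiff (Suc i) (ddiff i (ddiff (Suc i) f)))"
      using d len fps 3 by (intro step) (simp_all add: sref_def)
    have "v \<circ> sref (Suc i) \<circ> sref i \<circ> sref (Suc i) = v \<circ> sref i \<circ> sref (Suc i) \<circ> sref i"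
      by (auto simp: fun_eq_iff sref_def)
    then show ?thesis
      using 1 2 4 5 i(3) 3 ddiff_braid by simp
  qed
qed

lemma perm_descent_induct [consumes 1, case_names id descent]:
  assumes "finperm v"
    and "Q id"
    and "\<And>v i. finperm v \<Longrightarrow> v (Suc i) < v i \<Longrightarrow> Q (v \<circ> sref i) \<Longrightarrow> Q v"
  shows "Q v"
  using assms(1)
proof (induction "perm_length v" arbitrary: v rule: less_induct)
  case less
  show ?case
  proof (cases "\<exists>i. v (Suc i) < v i")
    case True
    then obtain i where i: "v (Suc i) < v i" by blast
    then have "Q (v \<circ> sref i)"
      using less perm_length_descent[OF less.prems i] finperm_comp_sref by simp
    with assms(3)[OF less.prems i] show ?thesis by simp
  next
    case False
    then show ?thesis using no_descent_id[OF less.prems] assms(2) by simp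
  qed
qed

lemma dop_add: "finperm v \<Longrightarrow> dop v (f + g) = dop v f + dop v g"
  by (induction v arbitrary: f g rule: perm_descent_induct) (simp_all add: dop_descent)

lemma dop_0: "finperm v \<Longrightarrow> dop v 0 = 0"
  using dop_add[of v 0 0] by simp

lemma dop_diff: "finperm v \<Longrightarrow> dop v (f - g) = dop v f - dop v g"
  using dop_add[of v "f - g" g] by simp

text \<open>At an ascent, \<open>ddiff i\<close> extends a reduced word of \<open>v\<close>. At a
  descent, a reduced word of \<open>v\<close> can be chosen that applies \<open>ddiff i\<close>
  first, and \<open>ddiff i\<close> squares to zero.\<close>

lemma dop_ddiff:
  assumes "finperm v"
  shows "dop v (ddiff i f) = (if v i < v (Suc i) then dop (v \<circ> sref i) f else 0)"
proof (cases "v i < v (Suc i)")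
  case True
  then show ?thesis
    using dop_descent[of "v \<circ> sref i" i f] assms
    by (simp add: finperm_comp_sref comp_assoc sref_comp_sref)
next
  case False
  then have "v (Suc i) < v i" using finperm_inj[OF assms] by (metis linorder_neqE_nat n_not_Suc_n)
  then show ?thesis
    using dop_descent[OF assms, of i "ddiff i f"] False assms
    by (simp add: finperm_comp_sref dop_0)
qed

section \<open>Commuting a variable past a divided difference\<close>

lemma sum_list_dop_ddiff:
  assumes "\<forall>u\<in>set Vs. finperm u"
  shows "(\<Sum>u\<leftarrow>Vs. dop u (ddiff i g))
       = (\<Sum>u\<leftarrow>map (\<lambda>u. u \<circ> sref i) (filter (\<lambda>u. u i < u (Suc i)) Vs). dop u g)"
  using assms by (induction Vs) (simp_all add: dop_ddiff)

text \<open>In the Chevalley rule the negative terms come from inversions \<open>(a, m)\<close> of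
  \<open>v\<close>, which the hypothesis excludes. About the remaining terms only their shorter
  length is recorded, as the later induction on length requires.\<close>

lemma dop_mult_var_max:
  assumes "finperm v" "\<And>a. a < m \<Longrightarrow> v a < v m"
  shows "\<exists>Vs. (\<forall>u\<in>set Vs. finperm u \<and> perm_length u < perm_length v) \<and>
    (\<forall>g. dop v (pvar (X m) * g) = pvar (X (v m)) * dop v g + (\<Sum>u\<leftarrow>Vs. dop u g))"
  using assms
proof (induction v arbitrary: m rule: perm_descent_induct)
  case id
  show ?case by (rule exI[of _ "[]"]) simp
next
  case (descent v i)
  let ?v = "v \<circ> sref i"
  \<comment> \<open>The case \<open>m = Suc i\<close> would bring in the minus sign of the twisted
    Leibniz rule.\<close>
  have ne: "m \<noteq> Suc i"
    using descent.hyps(2) descent.prems[of i] by auto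
  have "?v a < ?v (sref i m)" if "a < sref i m" for a
  proof -
    have "sref i a < m \<or> sref i a = Suc i \<and> m = i"
      using that ne by (auto simp: sref_def split: if_splits)
    then show ?thesis using descent.hyps(2) descent.prems[of "sref i a"] by auto
  qed
  from descent.IH[OF this] obtain Vs where
    Vs: "\<forall>u\<in>set Vs. finperm u \<and> perm_length u < perm_length ?v"
    "\<And>g. dop ?v (pvar (X (sref i m)) * g) = pvar (X (v m)) * dop ?v g + (\<Sum>u\<leftarrow>Vs. dop u g)"
    by (auto simp: comp_def)
  have len: "perm_length v = Suc (perm_length ?v)"
    using perm_length_descent descent.hyps by blast
  have fp: "finperm ?v" using descent.hyps(1) by (rule finperm_comp_sref)
  \<comment> \<open>An old term \<open>u\<close> survives \<open>ddiff i\<close> only if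
    \<open>i\<close> is an ascent of \<open>u\<close>, and then gains one in length; the extra
    \<open>?v\<close> is the Leibniz correction.\<close>
  let ?Us = "map (\<lambda>u. u \<circ> sref i) (filter (\<lambda>u. u i < u (Suc i)) Vs) @ (if m = i then [?v] else [])"
  have "\<forall>u\<in>set ?Us. finperm u \<and> perm_length u < perm_length v"
    using Vs(1) len fp by (auto simp: finperm_comp_sref perm_length_ascent)
  moreover have "dop v (pvar (X m) * g) = pvar (X (v m)) * dop v g + (\<Sum>u\<leftarrow>?Us. dop u g)" for g
  proof -
    have "dop v (pvar (X m) * g)
        = dop ?v (pvar (X (sref i m)) * ddiff i g) + (if m = i then dop ?v g else 0)"
      using ne fp by (simp add: dop_descent[OF descent.hyps] ddiff_mult_var dop_add dop_0)
    then show ?thesis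
      using Vs by (simp add: Vs(2) sum_list_dop_ddiff dop_descent[OF descent.hyps])
  qed
  ultimately show ?case by blast
qed

text \<open>The mirror image: no inversion of \<open>v\<close> starts at \<open>m\<close>, so only
  the negative Chevalley terms are left.\<close>

lemma dop_mult_var_min:
  assumes "finperm v" "\<And>c. m < c \<Longrightarrow> v m < v c"
  shows "\<exists>Vs. (\<forall>u\<in>set Vs. finperm u \<and> perm_length u < perm_length v) \<and>
    (\<forall>g. dop v (pvar (X m) * g) = pvar (X (v m)) * dop v g - (\<Sum>u\<leftarrow>Vs. dop u g))"
  using assms
proof (induction v arbitrary: m rule: perm_descent_induct)
  case id
  show ?case by (rule exI[of _ "[]"]) simp
next
  case (descent v i)
  let ?v = "v \<circ> sref i"
  have ne: "m \<noteq> i"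
    using descent.hyps(2) descent.prems[of "Suc i"] by auto
  have "?v (sref i m) < ?v c" if "sref i m < c" for c
  proof -
    have "m < sref i c \<or> sref i c = i \<and> m = Suc i"
      using that ne by (auto simp: sref_def split: if_splits)
    then show ?thesis using descent.hyps(2) descent.prems[of "sref i c"] by auto
  qed
  from descent.IH[OF this] obtain Vs where
    Vs: "\<forall>u\<in>set Vs. finperm u \<and> perm_length u < perm_length ?v"
    "\<And>g. dop ?v (pvar (X (sref i m)) * g) = pvar (X (v m)) * dop ?v g - (\<Sum>u\<leftarrow>Vs. dop u g)"
    by (auto simp: comp_def)
  have len: "perm_length v = Suc (perm_length ?v)"
    using perm_length_descent descent.hyps by blast
  have fp: "finperm ?v" using descent.hyps(1) by (rule finperm_comp_sref)
  let ?Us = "map (\<lambda>u. u \<circ> sref i) (filter (\<lambda>u. u i < u (Suc i)) Vs) @ (if m = Suc i then [?v] else [])"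
  have "\<forall>u\<in>set ?Us. finperm u \<and> perm_length u < perm_length v"
    using Vs(1) len fp by (auto simp: finperm_comp_sref perm_length_ascent)
  moreover have "dop v (pvar (X m) * g) = pvar (X (v m)) * dop v g - (\<Sum>u\<leftarrow>?Us. dop u g)" for g
  proof -
    have "dop v (pvar (X m) * g)
        = dop ?v (pvar (X (sref i m)) * ddiff i g) - (if m = Suc i then dop ?v g else 0)"
      using ne by (simp add: dop_descent[OF descent.hyps] ddiff_mult_var dop_diff[OF fp])
    then show ?thesis
      using Vs by (simp add: Vs(2) sum_list_dop_ddiff dop_descent[OF descent.hyps])
  qed
  ultimately show ?case by blast
qed

section \<open>Inserting an equivariant parameter\<close>

text \<open>Position and parameter are kept independent so that the position can move while the
  parameter stays. \<open>Rminus i\<close> is \<open>ins i i\<close>, and \<open>Rplus i\<close> is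
  \<open>ins (Suc i) i\<close>.\<close>

definition ins :: "nat \<Rightarrow> nat \<Rightarrow> poly \<Rightarrow> poly" where
  "ins i b = psubst (\<lambda>v. case v of
      X j \<Rightarrow> (if j < i then pvar (X j) else if j = i then pvar (T b) else pvar (X (j - 1)))
    | T j \<Rightarrow> pvar (T j))"

definition evt :: "(nat \<Rightarrow> nat) \<Rightarrow> poly \<Rightarrow> poly" where
  "evt \<tau> = psubst (\<lambda>v. case v of X j \<Rightarrow> pvar (T (\<tau> j)) | T j \<Rightarrow> pvar (T j))"

text \<open>Composing on the right, \<open>\<tau> \<circ> skip k\<close> is the parameter sequence
  \<open>\<tau>\<close> with its entry at \<open>k\<close> dropped.\<close>

definition skip :: "nat \<Rightarrow> nat \<Rightarrow> nat" where
  "skip i j = (if j < i then j else Suc j)"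

lemma ins_swapx_self: "ins i b (swapx i f) = ins (Suc i) b f"
  "ins (Suc i) b (swapx i f) = ins i b f"
  unfolding ins_def swapx_def psubst_psubst
  by (rule psubst_cong; auto simp: sref_def split: var.split)+

lemma ins_swapx_below:
  assumes "Suc j < i" shows "ins i b (swapx j f) = swapx j (ins i b f)"
  unfolding ins_def swapx_def psubst_psubst using assms
  by (intro psubst_cong) (auto simp: sref_def split: var.split)

lemma ins_swapx_above:
  assumes "i \<le> j" shows "ins i b (swapx (Suc j) f) = swapx j (ins i b f)"
  unfolding ins_def swapx_def psubst_psubst using assms
  by (intro psubst_cong) (auto simp: sref_def split: var.split)

lemma ins_hom:
  "ins i b (p + q) = ins i b p + ins i b q"
  "ins i b (p - q) = ins i b p - ins i b q"
  "ins i b (p * q) = ins i b p * ins i b q"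
  "ins i b (pvar (X j)) = (if j < i then pvar (X j) else if j = i then pvar (T b) else pvar (X (j - 1)))"
  by (simp_all add: ins_def)

lemma ddiff_ins_below:
  assumes "Suc j < i" shows "ddiff j (ins i b f) = ins i b (ddiff j f)"
  using arg_cong[OF ddiff_eq[of j f], of "ins i b"] assms
  by (intro ddiff_unique) (simp add: ins_hom ins_swapx_below)

text \<open>The variables behind the inserted slot move down by one, hence the index shift. Together
  with \<open>ddiff_ins_below\<close> only \<open>Suc j = i\<close> is left out: there the two
  variables come from \<open>X (i - 1)\<close> and \<open>X (Suc i)\<close>, which are not
  adjacent.\<close>

lemma ddiff_ins_above:
  assumes "i \<le> j" shows "ddiff j (ins i b f) = ins i b (ddiff (Suc j) f)"
  using arg_cong[OF ddiff_eq[of "Suc j" f], of "ins i b"] assms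
  by (intro ddiff_unique) (simp add: ins_hom ins_swapx_above)

text \<open>A swap before the insertion shifts the insertion by one position, so the difference of
  the two insertions is the image of a multiple of \<open>ddiff i f\<close>.\<close>

lemma ins_Suc:
  "ins (Suc i) b f = ins i b f + (pvar (X i) - pvar (T b)) * ins i b (ddiff i f)"
  using arg_cong[OF ddiff_eq[of i f], of "ins i b"]
  by (simp add: ins_hom ins_swapx_self algebra_simps)

text \<open>The same comparison, with \<open>ddiff i f\<close> under the other insertion. The linear
  factor now has the opposite sign, which allows a positive move in the other direction.\<close>

lemma ins_eq_ins_Suc:
  "ins i b f = ins (Suc i) b f + (pvar (T b) - pvar (X i)) * ins (Suc i) b (ddiff i f)"
  using arg_cong[OF ddiff_eq[of i f], of "ins (Suc i) b"]
  by (simp add: ins_hom ins_swapx_self algebra_simps)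

lemma swapx_pvar_T [simp]: "swapx i (pvar (T b)) = pvar (T b)"
  by (simp add: swapx_def)

lemma ddiff_mult_T: "ddiff i (pvar (T b) * f) = pvar (T b) * ddiff i f"
  using ddiff_eq[of i f] by (intro ddiff_unique) (simp flip: right_diff_distrib add: mult.left_commute)

lemma dop_mult_T: "finperm v \<Longrightarrow> dop v (pvar (T b) * f) = pvar (T b) * dop v f"
  by (induction v arbitrary: f rule: perm_descent_induct) (simp_all add: dop_descent ddiff_mult_T)

lemma evt_hom:
  "evt \<tau> (p + q) = evt \<tau> p + evt \<tau> q"
  "evt \<tau> (p - q) = evt \<tau> p - evt \<tau> q"
  "evt \<tau> (p * q) = evt \<tau> p * evt \<tau> q"
  "evt \<tau> (pvar (X j)) = pvar (T (\<tau> j))" "evt \<tau> (pvar (T j)) = pvar (T j)"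
  by (simp_all add: evt_def)

lemma evt_sum_list: "evt \<tau> (sum_list ps) = (\<Sum>p\<leftarrow>ps. evt \<tau> p)"
  by (simp add: evt_def psubst_sum_list)

text \<open>When position and parameter match, the insertion substitutes exactly what the evaluation
  would.\<close>

lemma evt_skip_ins: "evt (\<tau> \<circ> skip k) (ins k (\<tau> k) f) = evt \<tau> f"
  unfolding evt_def ins_def psubst_psubst
  by (rule psubst_cong) (auto simp: skip_def split: var.split)

text \<open>For \<open>\<tau> = id\<close> and \<open>f\<close> in the span of the double Schubert polynomials, the polynomials
  \<open>evt id (dop v f)\<close> are the coefficients of \<open>f\<close>.\<close>
definition schubert_positive :: "(nat \<Rightarrow> nat) \<Rightarrow> poly \<Rightarrow> bool" where
  "schubert_positive \<tau> f \<longleftrightarrow> (\<forall>v. finperm v \<longrightarrow> graham_positive (evt \<tau> (dop v f)))"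

lemma schubert_positive_ddiff:
  assumes "schubert_positive \<tau> f" shows "schubert_positive \<tau> (ddiff i f)"
  using assms unfolding schubert_positive_def
  by (auto simp: dop_ddiff finperm_comp_sref evt_def graham_positive_0)

section \<open>Positivity of insertions\<close>

lemma less_if_ascents:
  fixes v :: "nat \<Rightarrow> nat"
  assumes "a < b" "\<And>c. a \<le> c \<Longrightarrow> c < b \<Longrightarrow> v c < v (Suc c)"
  shows "v a < v b"
  using assms
proof (induction b)
  case (Suc b)
  then show ?case by (cases "a = b") (auto intro: less_trans)
qed simp

text \<open>Induction on the distance between \<open>i\<close> and \<open>k\<close>, written with
  truncated subtraction. The position moves towards \<open>k\<close>; as \<open>\<tau>\<close> is
  increasing, the linear factor evaluates to a later minus an earlier parameter. At
  \<open>i = k\<close> the insertion is invisible to the evaluation.\<close>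

lemma graham_positive_ins_id:
  assumes \<tau>: "strict_mono \<tau>" and "schubert_positive \<tau> f"
  shows "graham_positive (evt (\<tau> \<circ> skip k) (ins i (\<tau> k) f))"
  using assms(2)
proof (induction "(i - k) + (k - i)" arbitrary: i f rule: less_induct)
  case less
  have le: "\<tau> a \<le> \<tau> b" if "a \<le> b" for a b
    using \<tau> that by (simp add: strict_mono_less_eq)
  note IH = less.hyps[OF _ less.prems] less.hyps[OF _ schubert_positive_ddiff[OF less.prems]]
  consider "i = k" | j where "i = Suc j" "k \<le> j" | "i < k"
    by (cases i) (auto simp: not_less_eq_eq, linarith)
  then show ?case
  proof cases
    case 1
    have "graham_positive (evt \<tau> (dop id f))"
      using less.prems finperm_id unfolding schubert_positive_def by blast
    with 1 show ?thesis by (simp add: evt_skip_ins)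
  next
    case 2
    then have "graham_positive (pvar (T (\<tau> (skip k j))) - pvar (T (\<tau> k)))"
      by (intro graham_positive_diff le) (simp add: skip_def)
    with IH[of j] 2 show ?thesis
      by (simp add: ins_Suc evt_hom graham_positive_add graham_positive_mult)
  next
    case 3
    then have "graham_positive (pvar (T (\<tau> k)) - pvar (T (\<tau> (skip k i))))"
      by (intro graham_positive_diff le) (simp add: skip_def)
    with IH[of "Suc i"] 3 show ?thesis
      by (subst ins_eq_ins_Suc) (simp add: evt_hom graham_positive_add graham_positive_mult)
  qed
qed

text \<open>If \<open>j = i - 1\<close> is the only descent of \<open>v\<close>, then \<open>k \<le> v j\<close> or \<open>v i < k\<close>; in the first case
  the parameter is moved to position \<open>i - 1\<close>, in the second to \<open>i + 1\<close>, and the descent can then be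
  commuted past the insertion.\<close>
lemma graham_positive_dop_ins:
  assumes \<tau>: "strict_mono \<tau>" and "finperm v" "schubert_positive \<tau> f"
  shows "graham_positive (evt (\<tau> \<circ> skip k) (dop v (ins i (\<tau> k) f)))"
  using assms(2,3)
proof (induction "perm_length v" arbitrary: v i f rule: less_induct)
  case less
  note fp = \<open>finperm v\<close> and pos = \<open>schubert_positive \<tau> f\<close>
  let ?ev = "evt (\<tau> \<circ> skip k)" and ?y = "pvar (T (\<tau> k))"
  have le: "\<tau> a \<le> \<tau> b" if "a \<le> b" for a b
    using \<tau> that by (simp add: strict_mono_less_eq)
  have shorter: "graham_positive (?ev (\<Sum>u\<leftarrow>Vs. dop u (ins i (\<tau> k) g)))"
    if "\<forall>u\<in>set Vs. finperm u \<and> perm_length u < perm_length v" "schubert_positive \<tau> g" for Vs i g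
    using that less.hyps by (auto simp: evt_sum_list intro!: graham_positive_sum_list)
  \<comment> \<open>A descent that does not straddle the inserted slot passes the insertion, leaving
    a shorter permutation and a divided difference that is still positive.\<close>
  have commute: "graham_positive (?ev (dop v (ins i (\<tau> k) g)))"
    if "v (Suc j) < v j" "Suc j \<noteq> i" "schubert_positive \<tau> g" for i j g
  proof -
    have "ddiff j (ins i (\<tau> k) g) = ins i (\<tau> k) (ddiff (if i \<le> j then Suc j else j) g)"
      using that(2) by (simp add: ddiff_ins_above ddiff_ins_below)
    then show ?thesis
      using less.hyps[of "v \<circ> sref j"] perm_length_descent[OF fp that(1)] that(3)
      by (simp add: dop_descent[OF fp that(1)] finperm_comp_sref[OF fp] schubert_positive_ddiff)
  qed
  show ?case
  proof (cases "\<exists>j. v (Suc j) < v j")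
    case False
    then have "v = id" using no_descent_id[OF fp] by blast
    then show ?thesis using graham_positive_ins_id[OF \<tau> pos] by simp
  next
    case True
    then obtain j where j: "v (Suc j) < v j" by blast
    show ?thesis
    proof (cases "\<exists>j. v (Suc j) < v j \<and> Suc j \<noteq> i")
      case True
      then show ?thesis using commute pos by blast
    next
      case False
      then have i: "i = Suc j" using j by blast
      have asc: "v c < v (Suc c)" if "c \<noteq> j" for c
      proof -
        have "\<not> v (Suc c) < v c" using False i that by auto
        moreover have "v (Suc c) \<noteq> v c" using finperm_inj[OF fp] by simp
        ultimately show ?thesis by linarith
      qed
      show ?thesis
      proof (cases "k \<le> v j")
        case True
        have "v a < v j" if "a < j" for a
          by (rule less_if_ascents[OF that]) (simp add: asc)
        then obtain Vs where Vs: "\<forall>u\<in>set Vs. finperm u \<and> perm_length u < perm_length v"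
          "\<And>g. dop v (pvar (X j) * g) = pvar (X (v j)) * dop v g + (\<Sum>u\<leftarrow>Vs. dop u g)"
          using dop_mult_var_max[OF fp, of j] by blast
        let ?h = "ins j (\<tau> k) (ddiff j f)"
        \<comment> \<open>With the slot at \<open>j\<close>, \<open>commute\<close> applies to both
          \<open>ins j (\<tau> k) f\<close> and \<open>?h\<close>; the Chevalley terms are covered
          by \<open>shorter\<close>.\<close>
        have eq: "ins i (\<tau> k) f = ins j (\<tau> k) f + (pvar (X j) * ?h - ?y * ?h)"
          by (simp add: i ins_Suc left_diff_distrib)
        have "?ev (dop v (ins i (\<tau> k) f)) = ?ev (dop v (ins j (\<tau> k) f))
            + ((pvar (T (\<tau> (skip k (v j)))) - ?y) * ?ev (dop v ?h) + ?ev (\<Sum>u\<leftarrow>Vs. dop u ?h))"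
          unfolding eq by (simp add: dop_add[OF fp] dop_diff[OF fp] dop_mult_T[OF fp] Vs(2) evt_hom
              left_diff_distrib)
        \<comment> \<open>Here \<open>skip k (v j)\<close> is \<open>Suc (v j)\<close>, which
          exceeds \<open>k\<close>.\<close>
        moreover have "graham_positive (pvar (T (\<tau> (skip k (v j)))) - ?y)"
          using True by (intro graham_positive_diff le) (simp add: skip_def)
        ultimately show ?thesis
          using commute[OF j, of j] shorter[OF Vs(1)] pos schubert_positive_ddiff[OF pos]
          by (simp add: graham_positive_add graham_positive_mult)
      next
        case False
        have "v i < v c" if "i < c" for c
          by (rule less_if_ascents[OF that]) (simp add: asc i)
        then obtain Vs where Vs: "\<forall>u\<in>set Vs. finperm u \<and> perm_length u < perm_length v"
          "\<And>g. dop v (pvar (X i) * g) = pvar (X (v i)) * dop v g - (\<Sum>u\<leftarrow>Vs. dop u g)"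
          using dop_mult_var_min[OF fp, of i] by blast
        let ?h = "ins (Suc i) (\<tau> k) (ddiff i f)"
        \<comment> \<open>Here \<open>pvar (X i)\<close> occurs with a minus sign, which turns the
          negative Chevalley terms positive.\<close>
        have eq: "ins i (\<tau> k) f = ins (Suc i) (\<tau> k) f + (?y * ?h - pvar (X i) * ?h)"
          by (subst ins_eq_ins_Suc) (simp add: left_diff_distrib)
        have "?ev (dop v (ins i (\<tau> k) f)) = ?ev (dop v (ins (Suc i) (\<tau> k) f))
            + ((?y - pvar (T (\<tau> (skip k (v i))))) * ?ev (dop v ?h) + ?ev (\<Sum>u\<leftarrow>Vs. dop u ?h))"
          unfolding eq by (simp add: dop_add[OF fp] dop_diff[OF fp] dop_mult_T[OF fp] Vs(2) evt_hom
              left_diff_distrib)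
        \<comment> \<open>Now \<open>v i < v j < k\<close>, so \<open>skip k\<close> fixes
          \<open>v i\<close>.\<close>
        moreover have "graham_positive (?y - pvar (T (\<tau> (skip k (v i)))))"
          using False j i by (intro graham_positive_diff le) (simp add: skip_def)
        ultimately show ?thesis
          using commute[OF j, of "Suc i"] i shorter[OF Vs(1)] pos schubert_positive_ddiff[OF pos]
          by (simp add: graham_positive_add graham_positive_mult)
      qed
    qed
  qed
qed

lemma schubert_positive_ins:
  assumes "strict_mono \<tau>" "schubert_positive \<tau> f"
  shows "schubert_positive (\<tau> \<circ> skip k) (ins k (\<tau> k) f)"
  using graham_positive_dop_ins[OF assms(1) _ assms(2)] by (simp add: schubert_positive_def)

section \<open>Indexed forests\<close>

lemma tdes_less: "a \<in> tdes t \<Longrightarrow> Suc a < leaves t"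
proof (induction t arbitrary: a)
  case (Node l r)
  then show ?case by (fastforce split: if_splits)
qed simp

lemma leaves_tdel: "a \<in> tdes t \<Longrightarrow> Suc (leaves (tdel a t)) = leaves t"
proof (induction t arbitrary: a)
  case (Node l r)
  show ?case
  proof (cases "l = Leaf \<and> r = Leaf")
    case False
    with Node.prems consider "a \<in> tdes l" | k where "k \<in> tdes r" "a = leaves l + k"
      by auto
    then show ?thesis
      by cases (use False tdes_less[of a l] Node.IH in auto)
  qed simp
qed simp

text \<open>Undoes \<open>tdel\<close> at a terminal node; it serves to show that trimming is
  injective.\<close>

fun tins :: "nat \<Rightarrow> tree \<Rightarrow> tree" where
  "tins i Leaf = Node Leaf Leaf"
| "tins i (Node l r) = (if i < leaves l then Node (tins i l) r
                        else Node l (tins (i - leaves l) r))"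

lemma tins_tdel: "a \<in> tdes t \<Longrightarrow> tins a (tdel a t) = t"
proof (induction t arbitrary: a)
  case (Node l r)
  then show ?case
    using tdes_less[of a l] leaves_tdel[of a l] by (auto split: if_splits)
qed simp

lemma tdes_nonempty: "t \<noteq> Leaf \<Longrightarrow> tdes t \<noteq> {}"
  by (induction t) auto

lemma offset_Suc: "offset F (Suc k) = offset F k + leaves (F k)"
  by (simp add: offset_def)

lemma offset_mono: "k \<le> l \<Longrightarrow> offset F k \<le> offset F l"
  unfolding offset_def by (intro sum_mono2) auto

lemma offset_cong: "(\<And>j. j < k \<Longrightarrow> F j = G j) \<Longrightarrow> offset F k = offset G k"
  by (simp add: offset_def)

lemma tree_of_leaf_eq:
  assumes "offset F k \<le> i" "i < offset F (Suc k)"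
  shows "tree_of_leaf F i = k"
  unfolding tree_of_leaf_def
proof (rule the_equality)
  fix l assume l: "offset F l \<le> i \<and> i < offset F (Suc l)"
  show "l = k"
  proof (rule ccontr)
    assume "l \<noteq> k"
    then consider "Suc l \<le> k" | "Suc k \<le> l" by linarith
    then show False using offset_mono[of "Suc l" k F] offset_mono[of "Suc k" l F] l assms
      by cases linarith+
  qed
qed (use assms in blast)

text \<open>Trimming keeps leaf \<open>i\<close> in the same tree and does not touch earlier trees.
  Hence the affected tree and its offset can be read off from \<open>fdel F i\<close> and
  \<open>i\<close> alone.\<close>

lemma Qdes_cases:
  assumes "i \<in> Qdes F"
  obtains k a where "a \<in> tdes (F k)" "i = offset F k + a" "fdel F i = F(k := tdel a (F k))"
    "tree_of_leaf (fdel F i) i = k" "offset (fdel F i) k = offset F k"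
proof -
  obtain k a where ka: "a \<in> tdes (F k)" "i = offset F k + a"
    using assms by (auto simp: Qdes_def)
  then have "tree_of_leaf F i = k"
    using tdes_less[OF ka(1)] by (intro tree_of_leaf_eq) (auto simp: offset_Suc)
  then have del: "fdel F i = F(k := tdel a (F k))"
    using ka by (simp add: fdel_def)
  then have off: "offset (fdel F i) k = offset F k"
    by (intro offset_cong) simp
  then have "tree_of_leaf (fdel F i) i = k"
    using ka tdes_less[OF ka(1)] leaves_tdel[OF ka(1)]
    by (intro tree_of_leaf_eq) (simp_all add: offset_Suc, simp add: del[unfolded ka(2)])
  with ka del off show ?thesis using that by blast
qed

text \<open>The place to split is determined by the trimmed forest, and \<open>tins\<close> restores
  the tree. In an expansion, trimming therefore never merges two coefficients.\<close>

lemma fdel_inj: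
  assumes "i \<in> Qdes F" "i \<in> Qdes G" "fdel F i = fdel G i"
  shows "F = G"
proof -
  obtain k a where F: "a \<in> tdes (F k)" "i = offset F k + a" "fdel F i = F(k := tdel a (F k))"
    "tree_of_leaf (fdel F i) i = k" "offset (fdel F i) k = offset F k"
    using Qdes_cases[OF assms(1)] by blast
  obtain l b where G: "b \<in> tdes (G l)" "i = offset G l + b" "fdel G i = G(l := tdel b (G l))"
    "tree_of_leaf (fdel G i) i = l" "offset (fdel G i) l = offset G l"
    using Qdes_cases[OF assms(2)] by blast
  have l: "l = k" using F(4) G(4) assms(3) by simp
  then have b: "b = a" using F(2,5) G(2,5) assms(3) by simp
  have eq: "F(k := tdel a (F k)) = G(k := tdel a (G k))"
    using F(3) G(3) assms(3) l b by simp
  show ?thesis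
  proof
    fix j
    show "F j = G j"
    proof (cases "j = k")
      case True
      then show ?thesis
        using fun_cong[OF eq, of k] tins_tdel[OF F(1)] tins_tdel[of a "G k"] G(1) l b
        by (metis fun_upd_same)
    next
      case False
      then show ?thesis using fun_cong[OF eq, of j] by simp
    qed
  qed
qed

text \<open>A binary tree with n leaves has n - 1 internal nodes, so this counts the internal nodes
  of the forest.\<close>

definition forest_size :: "forest \<Rightarrow> nat" where
  "forest_size F = (\<Sum>k | F k \<noteq> Leaf. leaves (F k) - 1)"

lemma forest_fdel:
  assumes "indexed_forest F" "i \<in> Qdes F"
  shows "indexed_forest (fdel F i)" "forest_size (fdel F i) < forest_size F"
proof -
  obtain k a where F: "a \<in> tdes (F k)" "fdel F i = F(k := tdel a (F k))"
    using Qdes_cases[OF assms(2)] by blast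
  let ?A = "{j. F j \<noteq> Leaf}" and ?G = "fdel F i"
  have fin: "finite ?A" using assms(1) by (simp add: indexed_forest_def)
  have k: "k \<in> ?A" using F(1) by auto
  have sub: "{j. ?G j \<noteq> Leaf} \<subseteq> ?A" using k by (auto simp: F(2))
  then show "indexed_forest ?G"
    using fin finite_subset by (auto simp: indexed_forest_def)
  have "forest_size ?G = (\<Sum>j\<in>?A. leaves (?G j) - 1)"
    unfolding forest_size_def using fin sub by (intro sum.mono_neutral_left) auto
  also have "\<dots> < (\<Sum>j\<in>?A. leaves (F j) - 1)"
    using fin k F(1) tdes_less[OF F(1)] leaves_tdel[OF F(1)]
    by (intro sum_strict_mono_ex1) (auto simp: F(2) intro!: bexI[of _ k])
  finally show "forest_size ?G < forest_size F" by (simp add: forest_size_def)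
qed

lemma Qdes_nonempty:
  assumes "F \<noteq> empty_forest" shows "Qdes F \<noteq> {}"
proof -
  obtain k where "F k \<noteq> Leaf" using assms by (auto simp: empty_forest_def)
  then show ?thesis using tdes_nonempty[of "F k"] by (auto simp: Qdes_def)
qed

section \<open>Expansions in double forest polynomials\<close>

text \<open>Each trimming omits one parameter; \<open>\<tau>\<close> keeps track of those that
  remain after several trimmings.\<close>

definition tsub :: "(nat \<Rightarrow> nat) \<Rightarrow> poly \<Rightarrow> poly" where
  "tsub \<tau> = psubst (\<lambda>v. case v of X j \<Rightarrow> pvar (X j) | T j \<Rightarrow> pvar (T (\<tau> j)))"

lemma ins_tsub:
  "ins (Suc i) (\<tau> i) (tsub \<tau> p) = tsub \<tau> (Rplus i p)"
  "ins i (\<tau> i) (tsub \<tau> p) = tsub \<tau> (Rminus i p)"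
  unfolding ins_def tsub_def Rplus_def Rminus_def psubst_psubst
  by (rule psubst_cong; auto split: var.split)+

lemma tsub_omit_t: "tsub \<tau> (omit_t i p) = tsub (\<tau> \<circ> skip i) p"
  unfolding tsub_def omit_t_def psubst_psubst
  by (rule psubst_cong) (auto simp: skip_def split: var.split)

lemma evt_tsub: "evt \<tau> (tsub \<tau> p) = tsub \<tau> (spec_tt p)"
  unfolding tsub_def evt_def spec_tt_def psubst_psubst
  by (rule psubst_cong) (auto split: var.split)

lemma tsub_id: "tsub id p = p"
proof -
  have "tsub id p = psubst pvar p"
    unfolding tsub_def by (rule psubst_cong) (simp split: var.split)
  then show ?thesis by (simp add: psubst_pvar_id)
qed

lemma Eop_eq: "(pvar (X i) - pvar (T i)) * Eop i f = Rplus i f - Rminus i f"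
proof -
  have eq: "(pvar (X i) - pvar (T i)) * ins i i (ddiff i f) = Rplus i f - Rminus i f"
    using ins_Suc[of i i f] ins_tsub[of i id f] by (simp add: tsub_id) (metis add_diff_cancel_left')
  have "Eop i f = ins i i (ddiff i f)"
    unfolding Eop_def
  proof (rule the_equality)
    fix g assume "(pvar (X i) - pvar (T i)) * g = Rplus i f - Rminus i f"
    then have "(pvar (X i) - pvar (T i)) * g = (pvar (X i) - pvar (T i)) * ins i i (ddiff i f)"
      by (simp only: eq)
    then show "g = ins i i (ddiff i f)" by simp
  qed (fact eq)
  with eq show ?thesis by simp
qed

text \<open>Induction on the number of internal nodes of \<open>F\<close>. Trimming at some
  \<open>i\<close> in \<open>Qdes F\<close> turns the expansion of \<open>f\<close> into one of
  \<open>ins i (\<tau> i) (ddiff i f)\<close>, in which the smaller forest \<open>fdel F i\<close>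
  carries the same coefficient. Positivity of the new function is
  \<open>schubert_positive_ins\<close>.\<close>

lemma coeff_graham_positive:
  assumes P: "is_double_forest_family P"
    and "strict_mono \<tau>" "schubert_positive \<tau> f"
    and "finite A" "\<forall>F\<in>A. indexed_forest F" "\<forall>F\<in>A. in_Zt (c F)"
    and "f = (\<Sum>F\<in>A. c F * tsub \<tau> (P F))" "F \<in> A"
  shows "graham_positive (c F)"
  using assms(2-)
proof (induction "forest_size F" arbitrary: F A c f \<tau> rule: less_induct)
  case less
  note fin = \<open>finite A\<close> and idx = \<open>\<forall>F\<in>A. indexed_forest F\<close> and Zt = \<open>\<forall>F\<in>A. in_Zt (c F)\<close>
  show ?case
  proof (cases "F = empty_forest")
    case True
    \<comment> \<open>Evaluation kills every forest polynomial except that of the empty forest and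
      fixes the coefficients.\<close>
    have "evt \<tau> f = (\<Sum>G\<in>A. evt \<tau> (c G) * evt \<tau> (tsub \<tau> (P G)))"
      by (simp add: less.prems(6) evt_def psubst_sum)
    also have "\<dots> = (\<Sum>G\<in>A. if G = F then c G else 0)"
    proof (rule sum.cong[OF refl])
      fix G assume "G \<in> A"
      then have "evt \<tau> (c G) = c G" using Zt unfolding evt_def by (intro psubst_in_Zt) auto
      moreover have "spec_tt (P G) = (if G = empty_forest then 1 else 0)"
        using P idx \<open>G \<in> A\<close> unfolding is_double_forest_family_def by blast
      ultimately show "evt \<tau> (c G) * evt \<tau> (tsub \<tau> (P G)) = (if G = F then c G else 0)"
        by (simp add: evt_tsub True) (simp add: tsub_def)
    qed
    also have "\<dots> = c F" using fin less.prems(7) by simp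
    finally have "evt \<tau> f = c F" .
    moreover have "graham_positive (evt \<tau> (dop id f))"
      using less.prems(2) finperm_id unfolding schubert_positive_def by blast
    ultimately show ?thesis by simp
  next
    case False
    then obtain i where i: "i \<in> Qdes F" using Qdes_nonempty by blast
    let ?B = "{G \<in> A. i \<in> Qdes G}" and ?\<tau> = "\<tau> \<circ> skip i" and ?g = "ins i (\<tau> i) (ddiff i f)"
    have inj: "inj_on (\<lambda>G. fdel G i) ?B" using fdel_inj by (auto intro!: inj_onI)
    \<comment> \<open>Transports the coefficients along the injective trimming map.\<close>
    define d where "d = (\<lambda>H. c (the_inv_into ?B (\<lambda>G. fdel G i) H))"
    have d: "d (fdel G i) = c G" if "G \<in> ?B" for G
      using the_inv_into_f_f[OF inj that] by (simp add: d_def)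
    have ins_c: "ins m b (c G) = c G" if "G \<in> A" for m b G
      using Zt that unfolding ins_def by (intro psubst_in_Zt) auto
    have ins_f: "ins m b f = (\<Sum>G\<in>A. c G * ins m b (tsub \<tau> (P G)))" for m b
    proof -
      have "ins m b f = (\<Sum>G\<in>A. ins m b (c G) * ins m b (tsub \<tau> (P G)))"
        by (simp add: less.prems(6) ins_def psubst_sum)
      also have "\<dots> = (\<Sum>G\<in>A. c G * ins m b (tsub \<tau> (P G)))" by (simp add: ins_c)
      finally show ?thesis .
    qed
    have E: "ins (Suc i) (\<tau> i) (tsub \<tau> (P G)) - ins i (\<tau> i) (tsub \<tau> (P G))
        = (pvar (X i) - pvar (T (\<tau> i))) * (if i \<in> Qdes G then tsub ?\<tau> (P (fdel G i)) else 0)"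
      if "G \<in> A" for G
    proof -
      have "Eop i (P G) = (if i \<in> Qdes G then omit_t i (P (fdel G i)) else 0)"
        using P idx that unfolding is_double_forest_family_def by blast
      with Eop_eq[of i "P G"] have "tsub \<tau> (Rplus i (P G) - Rminus i (P G))
          = tsub \<tau> ((pvar (X i) - pvar (T i)) * (if i \<in> Qdes G then omit_t i (P (fdel G i)) else 0))"
        by simp
      also have "\<dots> = (pvar (X i) - pvar (T (\<tau> i)))
          * (if i \<in> Qdes G then tsub \<tau> (omit_t i (P (fdel G i))) else 0)"
        by (simp add: tsub_def)
      finally show ?thesis
        unfolding ins_tsub tsub_omit_t by (simp add: tsub_def)
    qed
    \<comment> \<open>The linear factor is carried along to avoid division and cancelled at the
      end.\<close>
    have "(pvar (X i) - pvar (T (\<tau> i))) * ?g = ins (Suc i) (\<tau> i) f - ins i (\<tau> i) f"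
      by (simp add: ins_Suc)
    also have "\<dots> = (\<Sum>G\<in>A. c G * ((pvar (X i) - pvar (T (\<tau> i)))
        * (if i \<in> Qdes G then tsub ?\<tau> (P (fdel G i)) else 0)))"
      unfolding ins_f sum_subtractf[symmetric] right_diff_distrib[symmetric] using E
      by (intro sum.cong) simp_all
    also have "\<dots> = (pvar (X i) - pvar (T (\<tau> i)))
        * (\<Sum>G\<in>A. c G * (if i \<in> Qdes G then tsub ?\<tau> (P (fdel G i)) else 0))"
      by (simp add: sum_distrib_left mult.left_commute)
    finally have "?g = (\<Sum>G\<in>A. c G * (if i \<in> Qdes G then tsub ?\<tau> (P (fdel G i)) else 0))"
      by simp
    also have "\<dots> = (\<Sum>G\<in>?B. c G * tsub ?\<tau> (P (fdel G i)))"
      using fin by (intro sum.mono_neutral_cong_right) auto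
    also have "\<dots> = (\<Sum>G\<in>?B. d (fdel G i) * tsub ?\<tau> (P (fdel G i)))"
      using d by simp
    also have "\<dots> = (\<Sum>H\<in>(\<lambda>G. fdel G i) ` ?B. d H * tsub ?\<tau> (P H))"
      using sum.reindex[OF inj, of "\<lambda>H. d H * tsub ?\<tau> (P H)"] by simp
    finally have exp: "?g = (\<Sum>H\<in>(\<lambda>G. fdel G i) ` ?B. d H * tsub ?\<tau> (P H))" .
    have "graham_positive (d (fdel F i))"
    proof (rule less.hyps[OF _ _ _ _ _ _ exp])
      show "forest_size (fdel F i) < forest_size F"
        using forest_fdel i idx less.prems(7) by blast
      have "strict_mono (skip i)" by (auto simp: strict_mono_def skip_def)
      then show "strict_mono ?\<tau>" using less.prems(1) by (simp add: strict_mono_def)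
      show "schubert_positive ?\<tau> ?g"
        using less.prems(1,2) by (intro schubert_positive_ins schubert_positive_ddiff)
      show "finite ((\<lambda>G. fdel G i) ` ?B)" using fin by simp
      show "\<forall>H\<in>(\<lambda>G. fdel G i) ` ?B. indexed_forest H" using forest_fdel(1) idx by blast
      show "\<forall>H\<in>(\<lambda>G. fdel G i) ` ?B. in_Zt (d H)" using Zt d by auto
      show "fdel F i \<in> (\<lambda>G. fdel G i) ` ?B" using i less.prems(7) by blast
    qed
    then show ?thesis using d i less.prems(7) by simp
  qed
qed

section \<open>Double Schubert polynomials\<close>

lemma schubert_positive_schubert:
  assumes S: "is_double_schubert_family S" and "finperm w"
  shows "schubert_positive id (S w)"
  unfolding schubert_positive_def
proof (intro allI impI)
  fix v assume v: "finperm v"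
  \<comment> \<open>With 0 included, the double Schubert polynomials are closed under all
    \<open>ddiff i\<close>, and every member evaluates to 0 or 1 at x = t.\<close>
  define Z where "Z = insert 0 (S ` Collect finperm)"
  have Z: "ddiff i f \<in> Z" if "f \<in> Z" for i f
    using that S finperm_comp_sref unfolding Z_def is_double_schubert_family_def by auto
  have "dop v f \<in> Z" if "f \<in> Z" for f
    using v that by (induction v arbitrary: f rule: perm_descent_induct) (simp_all add: dop_descent Z)
  then have "dop v (S w) \<in> Z" using assms(2) by (simp add: Z_def)
  moreover have "evt id f = spec_tt f" for f
    unfolding evt_def spec_tt_def by (rule psubst_cong) (simp split: var.split)
  moreover have "spec_tt f \<in> {0, 1}" if "f \<in> Z" for f
    using that S unfolding Z_def is_double_schubert_family_def by (auto simp: spec_tt_def)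
  ultimately have "evt id (dop v (S w)) \<in> {0, 1}" by simp
  then show "graham_positive (evt id (dop v (S w)))"
    using graham_positive_0 graham_positive_1 by auto
qed

theorem theorem11p7:
  fixes S :: "(nat \<Rightarrow> nat) \<Rightarrow> poly" and P :: "forest \<Rightarrow> poly"
    and w :: "nat \<Rightarrow> nat" and A :: "forest set" and c :: "forest \<Rightarrow> poly"
  assumes "is_double_schubert_family S"
    and "is_double_forest_family P"
    and "finperm w"
    and "finite A" and "\<forall>F\<in>A. indexed_forest F"
    and "\<forall>F\<in>A. in_Zt (c F)"
    and "S w = (\<Sum>F\<in>A. c F * P F)"
  shows "\<forall>F\<in>A. graham_positive (c F)"
proof
  fix F assume "F \<in> A"
  \<comment> \<open>The induction starts with no parameter omitted, that is, with
    \<open>\<tau> = id\<close>.\<close>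
  have "S w = (\<Sum>F\<in>A. c F * tsub id (P F))"
    using assms(7) by (simp add: tsub_id)
  from coeff_graham_positive[OF assms(2) _ schubert_positive_schubert[OF assms(1,3)] assms(4-6) this \<open>F \<in> A\<close>]
  show "graham_positive (c F)" by (simp add: strict_mono_def)
qed

end
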